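(* Let $1\le p<q<\infty$ and $\alpha>0$. Then $$L^{q),\alpha}(\Omega)=\bigl(L^p(\Omega),L^q(\Omega)\bigr)_{1,\infty;-\frac{\alpha}{q}}$$ with equivalent norms, i.e. $\|f\|_{q),\alpha}\approx\sup_{0<t<1}t^{-1}(1-\log t)^{-\alpha/q}K(f,t;L^p,L^q)$ with constants independent of $f$.
   Context: $\Omega\subset\mathbb R^n$ is a bounded open set with $|\Omega|=1$; $f_*$ is the decreasing rearrangement of $|f|$ on $(0,1)$; $\log$ is the natural logarithm. Grand Lebesgue space: for $1<q<\infty$, $\alpha>0$, $L^{q),\alpha}(\Omega)$ is the set of measurable $f$ with $\|f\|_{q),\alpha}=\sup_{0<t<1}(1-\log t)^{-\alpha/q}(\int_t^1 f_*^q)^{1/q}<\infty$. K-functional: $K(g,t;X_0,X_1)=\inf_{g=g_0+g_1}(\|g_0\|_{X_0}+t\|g_1\|_{X_1})$. For $\gamma\in\mathbb R$, $(X_0,X_1)_{1,\infty;\gamma}$ is the set of $g\in X_0+X_1$ with $\sup_{0<t<1}t^{-1}(1-\log t)^{\gamma}K(g,t;X_0,X_1)<\infty$, this supremum being the norm. *)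

theory Defs
  imports "HOL-Analysis.Analysis"
begin

text \<open>Real powers of extended nonnegative reals (r > 0): infinity stays infinity.\<close>
definition enn_powr :: "ennreal \<Rightarrow> real \<Rightarrow> ennreal" where
  "enn_powr x r = (if x = top then top else ennreal (enn2real x powr r))"

definition Lp_norm :: "'a::euclidean_space set \<Rightarrow> real \<Rightarrow> ('a \<Rightarrow> real) \<Rightarrow> ennreal" where
  "Lp_norm \<Omega> p g = enn_powr (\<integral>\<^sup>+ x\<in>\<Omega>. ennreal (\<bar>g x\<bar> powr p) \<partial>lebesgue) (1 / p)"

definition distrib_fun :: "'a::euclidean_space set \<Rightarrow> ('a \<Rightarrow> real) \<Rightarrow> real \<Rightarrow> ennreal" where
  "distrib_fun \<Omega> f s = emeasure lebesgue {x \<in> \<Omega>. s < \<bar>f x\<bar>}"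

definition decr_rearr :: "'a::euclidean_space set \<Rightarrow> ('a \<Rightarrow> real) \<Rightarrow> real \<Rightarrow> ennreal" where
  "decr_rearr \<Omega> f t = Inf {ennreal s | s. 0 \<le> s \<and> distrib_fun \<Omega> f s \<le> ennreal t}"

definition grand_norm :: "'a::euclidean_space set \<Rightarrow> real \<Rightarrow> real \<Rightarrow> ('a \<Rightarrow> real) \<Rightarrow> ennreal" where
  "grand_norm \<Omega> q \<alpha> f =
     (SUP t\<in>{0<..<1}. ennreal ((1 - ln t) powr (- \<alpha> / q)) *
        enn_powr (\<integral>\<^sup>+ s\<in>{t<..<1}. enn_powr (decr_rearr \<Omega> f s) q \<partial>lborel) (1 / q))"

definition K_fun :: "'a::euclidean_space set \<Rightarrow> real \<Rightarrow> real \<Rightarrow> ('a \<Rightarrow> real) \<Rightarrow> real \<Rightarrow> ennreal" where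
  "K_fun \<Omega> p q g t = Inf {Lp_norm \<Omega> p g0 + ennreal t * Lp_norm \<Omega> q g1 | g0 g1.
      g0 \<in> borel_measurable (lebesgue_on \<Omega>) \<and> g1 \<in> borel_measurable (lebesgue_on \<Omega>) \<and>
      (\<forall>x\<in>\<Omega>. g x = g0 x + g1 x)}"

definition interp_norm :: "'a::euclidean_space set \<Rightarrow> real \<Rightarrow> real \<Rightarrow> real \<Rightarrow> ('a \<Rightarrow> real) \<Rightarrow> ennreal" where
  "interp_norm \<Omega> p q \<gamma> g =
     (SUP t\<in>{0<..<1}. ennreal (t powr (-1) * (1 - ln t) powr \<gamma>) * K_fun \<Omega> p q g t)"

end

theory Submission
  imports Defs
begin

text \<open>
  The function and its decreasing rearrangement are equimeasurable, so everything reduces to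
  one variable. For \<open>1 / \<theta> = 1 / p - 1 / q\<close> and \<open>s = t powr \<theta>\<close>, Markov's inequality for the
  \<open>L\<^sup>p\<close>-part of a decomposition bounds the tail \<open>(\<integral>\<^sub>s\<^sup>1 f\<^sub>*\<^sup>q)\<^bsup>1/q\<^esup>\<close> by a constant times
  \<open>K(f, t) / t\<close>, and \<open>ln t\<close> and \<open>ln s\<close> are comparable.
  Conversely, truncating \<open>f\<close> at height \<open>f\<^sub>*(s)\<close> bounds \<open>K(f, t)\<close> by the head
  \<open>(\<integral>\<^sub>0\<^sup>s f\<^sub>*\<^sup>p)\<^bsup>1/p\<^esup>\<close> plus \<open>t\<close> times the tail. As \<open>f\<^sub>*\<close> is decreasing,
  \<open>(r / 2) f\<^sub>*(r)\<^sup>q \<le> \<integral>\<^bsub>r/2\<^esub>\<^sup>1 f\<^sub>*\<^sup>q\<close>, so a finite grand Lebesgue norm bounds \<open>f\<^sub>*\<close> pointwise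
  well enough to control the head, because \<open>p / q < 1\<close>.
\<close>

section \<open>Equimeasurability of a function and its decreasing rearrangement\<close>

lemma superlevel_measurable:
  fixes f :: "'a::euclidean_space \<Rightarrow> real"
  assumes "\<Omega> \<in> sets lebesgue" "f \<in> borel_measurable (lebesgue_on \<Omega>)"
  shows "{x \<in> \<Omega>. s < \<bar>f x\<bar>} \<in> sets lebesgue"
proof -
  have "{x \<in> space (lebesgue_on \<Omega>). s < \<bar>f x\<bar>} \<in> sets (lebesgue_on \<Omega>)"
    using assms(2) by measurable
  then show ?thesis
    using assms(1) by (simp add: sets_restrict_space_iff)
qed

lemma distrib_fun_antimono:
  assumes "\<Omega> \<in> sets lebesgue" "f \<in> borel_measurable (lebesgue_on \<Omega>)" "s \<le> s'"
  shows "distrib_fun \<Omega> f s' \<le> distrib_fun \<Omega> f s"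
  unfolding distrib_fun_def using assms
  by (intro emeasure_mono superlevel_measurable) auto

text \<open>The infimum that defines the rearrangement is attained: the superlevel sets at heights s
  + 1/(n+1) increase to the one at height s, so the distribution function is continuous from the
  right. The resulting Galois connection is the only way in which the definition is used from here
  on, apart from monotonicity.\<close>

lemma decr_rearr_le_iff:
  assumes "\<Omega> \<in> sets lebesgue" "f \<in> borel_measurable (lebesgue_on \<Omega>)" "0 \<le> s"
  shows "decr_rearr \<Omega> f t \<le> ennreal s \<longleftrightarrow> distrib_fun \<Omega> f s \<le> ennreal t"
proof
  assume "distrib_fun \<Omega> f s \<le> ennreal t"
  then show "decr_rearr \<Omega> f t \<le> ennreal s"
    unfolding decr_rearr_def using assms(3) by (intro Inf_lower) auto
next
  assume le: "decr_rearr \<Omega> f t \<le> ennreal s"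
  let ?A = "\<lambda>n::nat. {x \<in> \<Omega>. s + 1 / Suc n < \<bar>f x\<bar>}"
  have U: "(\<Union>n. ?A n) = {x \<in> \<Omega>. s < \<bar>f x\<bar>}"
  proof (intro equalityI subsetI)
    fix x assume "x \<in> {x \<in> \<Omega>. s < \<bar>f x\<bar>}"
    then have x: "x \<in> \<Omega>" "0 < \<bar>f x\<bar> - s" by auto
    obtain n where "1 / Suc n < \<bar>f x\<bar> - s"
      using nat_approx_posE[OF x(2)] by auto
    then have "s + 1 / Suc n < \<bar>f x\<bar>" by linarith
    then show "x \<in> (\<Union>n. ?A n)" using x(1) by blast
  next
    fix x assume "x \<in> (\<Union>n. ?A n)"
    then obtain n where "x \<in> \<Omega>" "s + 1 / Suc n < \<bar>f x\<bar>" by auto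
    moreover have "0 < 1 / real (Suc n)" by simp
    ultimately have "x \<in> \<Omega>" "s < \<bar>f x\<bar>" by linarith+
    then show "x \<in> {x \<in> \<Omega>. s < \<bar>f x\<bar>}" by simp
  qed
  have "incseq ?A"
  proof (rule incseq_SucI, safe)
    fix n x assume "s + 1 / Suc n < \<bar>f x\<bar>"
    moreover have "1 / real (Suc (Suc n)) \<le> 1 / real (Suc n)" by (simp add: field_simps)
    ultimately show "s + 1 / Suc (Suc n) < \<bar>f x\<bar>" by linarith
  qed
  then have *: "distrib_fun \<Omega> f s = (SUP n. distrib_fun \<Omega> f (s + 1 / Suc n))"
    unfolding distrib_fun_def U[symmetric]
    by (intro SUP_emeasure_incseq[symmetric])
       (auto intro: superlevel_measurable[OF assms(1,2)])
  show "distrib_fun \<Omega> f s \<le> ennreal t"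
    unfolding *
  proof (rule SUP_least)
    fix n :: nat
    have "decr_rearr \<Omega> f t < ennreal (s + 1 / Suc n)"
      using assms(3) by (intro le_less_trans[OF le] ennreal_lessI add_nonneg_pos) auto
    then obtain r where r: "0 \<le> r" "distrib_fun \<Omega> f r \<le> ennreal t" "ennreal r < ennreal (s + 1 / Suc n)"
      unfolding decr_rearr_def Inf_less_iff by auto
    then have "r \<le> s + 1 / Suc n"
      by (simp add: ennreal_less_iff)
    then show "distrib_fun \<Omega> f (s + 1 / Suc n) \<le> ennreal t"
      using distrib_fun_antimono[OF assms(1,2)] r(2) order_trans by blast
  qed
qed

lemma decr_rearr_antimono: "t \<le> t' \<Longrightarrow> decr_rearr \<Omega> f t' \<le> decr_rearr \<Omega> f t"
  unfolding decr_rearr_def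
  by (rule Inf_superset_mono) (use ennreal_leI[of t t'] order_trans in blast)

lemma borel_measurable_decr_rearr:
  assumes "\<Omega> \<in> sets lebesgue" "f \<in> borel_measurable (lebesgue_on \<Omega>)"
  shows "decr_rearr \<Omega> f \<in> borel_measurable borel"
proof (rule borel_measurableI_greater)
  fix y
  show "{x \<in> space borel. y < decr_rearr \<Omega> f x} \<in> sets borel"
  proof (cases y)
    case (real s)
    have "{x \<in> space borel. y < decr_rearr \<Omega> f x} = {x. ennreal x < distrib_fun \<Omega> f s}"
      using decr_rearr_le_iff[OF assms real(1)] real(2) by (simp add: not_le[symmetric])
    also have "\<dots> \<in> sets borel" by measurable
    finally show ?thesis .
  qed simp
qed

text \<open>As f is real valued, its superlevel sets at integer heights decrease to the empty set.
  Finite measure gives continuity from above, so one of these sets has measure below t.\<close>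

lemma decr_rearr_less_top:
  assumes "\<Omega> \<in> sets lebesgue" "emeasure lebesgue \<Omega> < \<infinity>" "f \<in> borel_measurable (lebesgue_on \<Omega>)" "0 < t"
  shows "decr_rearr \<Omega> f t < top"
proof -
  let ?A = "\<lambda>n::nat. {x \<in> \<Omega>. real n < \<bar>f x\<bar>}"
  have "(\<Inter>n. ?A n) = {}"
  proof (intro equals0I)
    fix x assume x: "x \<in> (\<Inter>n. ?A n)"
    obtain n :: nat where "\<bar>f x\<bar> < real n" using reals_Archimedean2 by blast
    moreover have "real n < \<bar>f x\<bar>" using x by blast
    ultimately show False by linarith
  qed
  moreover have "(INF n. emeasure lebesgue (?A n)) = emeasure lebesgue (\<Inter>n. ?A n)"
  proof (rule INF_emeasure_decseq)
    show "range ?A \<subseteq> sets lebesgue" using superlevel_measurable[OF assms(1,3)] by auto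
    show "decseq ?A" by (rule decseq_SucI) auto
    fix n
    have "emeasure lebesgue (?A n) \<le> emeasure lebesgue \<Omega>"
      using assms(1) by (intro emeasure_mono) auto
    then show "emeasure lebesgue (?A n) \<noteq> \<infinity>" using assms(2) by (auto simp: top_unique)
  qed
  ultimately have "(INF n. distrib_fun \<Omega> f (real n)) < ennreal t"
    using assms(4) by (simp add: distrib_fun_def)
  then obtain n :: nat where "distrib_fun \<Omega> f (real n) < ennreal t"
    by (auto simp: INF_less_iff)
  then have "decr_rearr \<Omega> f t \<le> ennreal (real n)"
    using decr_rearr_le_iff[OF assms(1,3)] by simp
  then show ?thesis by (rule le_less_trans) simp
qed

text \<open>It suffices to compare the image measures on open rays. By the Galois connection, the
  set where the rearrangement exceeds s is the interval from 0 to
  \<open>distrib_fun \<Omega> f s\<close>, whose length is the measure of the corresponding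
  superlevel set of f.\<close>

lemma distr_decr_rearr:
  assumes "\<Omega> \<in> sets lebesgue" "emeasure lebesgue \<Omega> = 1" "f \<in> borel_measurable (lebesgue_on \<Omega>)"
  shows "distr (lebesgue_on \<Omega>) borel (\<lambda>x. ennreal \<bar>f x\<bar>)
       = distr (restrict_space lborel {0<..<1}) borel (decr_rearr \<Omega> f)" (is "?M = ?N")
proof -
  \<comment> \<open>The whole space is added to the rays so that the constant sequence
    \<open>UNIV\<close> can serve as the exhausting sequence of finite measure in the uniqueness
    theorem.\<close>
  let ?E = "insert UNIV (range greaterThan) :: ennreal set set"
  note [measurable] = borel_measurable_decr_rearr[OF assms(1,3)] assms(3)
  have sg: "sets borel = sigma_sets UNIV ?E"
  proof -
    have "sigma_sets UNIV ?E = sigma_sets UNIV (range greaterThan :: ennreal set set)"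
      by (rule sigma_sets_eqI) (auto intro: sigma_sets_top)
    then show ?thesis by (simp add: borel_Ioi)
  qed
  have m1: "emeasure ?M A = emeasure lebesgue {x \<in> \<Omega>. ennreal \<bar>f x\<bar> \<in> A}" if "A \<in> sets borel" for A
  proof -
    have "emeasure ?M A = emeasure (lebesgue_on \<Omega>) ((\<lambda>x. ennreal \<bar>f x\<bar>) -` A \<inter> space (lebesgue_on \<Omega>))"
      using that by (intro emeasure_distr) auto
    also have "\<dots> = emeasure lebesgue ((\<lambda>x. ennreal \<bar>f x\<bar>) -` A \<inter> space (lebesgue_on \<Omega>))"
      using assms(1) by (intro emeasure_restrict_space) auto
    also have "(\<lambda>x. ennreal \<bar>f x\<bar>) -` A \<inter> space (lebesgue_on \<Omega>) = {x \<in> \<Omega>. ennreal \<bar>f x\<bar> \<in> A}" by auto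
    finally show ?thesis .
  qed
  have m2: "emeasure ?N A = emeasure lborel {t \<in> {0<..<1}. decr_rearr \<Omega> f t \<in> A}" if "A \<in> sets borel" for A
  proof -
    have "emeasure ?N A = emeasure (restrict_space lborel {0<..<1})
        (decr_rearr \<Omega> f -` A \<inter> space (restrict_space lborel {0<..<1}))"
      using that by (intro emeasure_distr) (auto intro!: measurable_restrict_space1)
    also have "\<dots> = emeasure lborel (decr_rearr \<Omega> f -` A \<inter> space (restrict_space lborel {0<..<1}))"
      by (intro emeasure_restrict_space) (auto simp: space_restrict_space)
    also have "decr_rearr \<Omega> f -` A \<inter> space (restrict_space lborel {0<..<1})
        = {t \<in> {0<..<1}. decr_rearr \<Omega> f t \<in> A}" by (auto simp: space_restrict_space)
    finally show ?thesis .
  qed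
  show ?thesis
  proof (rule measure_eqI_generator_eq[where E = ?E and \<Omega> = UNIV and A = "\<lambda>_. UNIV"])
    show "Int_stable ?E"
    proof (rule Int_stableI)
      have *: "{a<..} \<inter> {b<..} = {max a b<..}" for a b :: ennreal by auto
      fix a b assume "a \<in> ?E" "b \<in> ?E"
      then show "a \<inter> b \<in> ?E" by (elim insertE imageE) (simp_all add: *)
    qed
    fix X assume "X \<in> ?E"
    then consider "X = UNIV" | a where "X = {a<..}" by auto
    then show "emeasure ?M X = emeasure ?N X"
    proof cases
      case 1
      moreover have "{t. 0 < t \<and> t < 1} = {0<..<1::real}" by auto
      ultimately show ?thesis using assms(2) by (simp add: m1 m2)
    next
      case (2 a)
      show ?thesis
      proof (cases a)
        case top
        then show ?thesis using 2 by (simp add: m1 m2)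
      next
        case (real s)
        define d where "d = distrib_fun \<Omega> f s"
        have "d \<le> 1"
          unfolding d_def distrib_fun_def assms(2)[symmetric] using assms(1)
          by (intro emeasure_mono) auto
        then obtain r where r: "0 \<le> r" "d = ennreal r" "r \<le> 1"
          by (cases d) (auto simp: top_unique)
        have "emeasure ?M X = d"
          using 2 real by (simp add: m1 d_def distrib_fun_def ennreal_less_iff)
        moreover have "{t \<in> {0<..<1}. decr_rearr \<Omega> f t \<in> X} = {0<..<r}"
        proof -
          have "decr_rearr \<Omega> f t \<in> X \<longleftrightarrow> t < r" if "0 < t" for t
            unfolding 2 real(2) greaterThan_iff not_le[symmetric] decr_rearr_le_iff[OF assms(1,3) real(1)]
              d_def[symmetric] r(2)
            using that by (simp add: ennreal_le_iff)
          then show ?thesis using r(3) by auto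
        qed
        ultimately show ?thesis using r 2 by (simp add: m2)
      qed
    qed
  next
    fix i :: nat
    show "emeasure ?M UNIV \<noteq> \<infinity>" using assms(2) by (simp add: m1)
  qed (auto simp: sg)
qed

lemma nn_integral_decr_rearr:
  assumes "\<Omega> \<in> sets lebesgue" "emeasure lebesgue \<Omega> = 1" "f \<in> borel_measurable (lebesgue_on \<Omega>)"
    and [measurable]: "\<phi> \<in> borel_measurable borel"
  shows "(\<integral>\<^sup>+x\<in>\<Omega>. \<phi> (ennreal \<bar>f x\<bar>) \<partial>lebesgue)
       = (\<integral>\<^sup>+t\<in>{0<..<1}. \<phi> (decr_rearr \<Omega> f t) \<partial>lborel)"
proof -
  note [measurable] = borel_measurable_decr_rearr[OF assms(1,3)] assms(3)
  have "(\<integral>\<^sup>+x\<in>\<Omega>. \<phi> (ennreal \<bar>f x\<bar>) \<partial>lebesgue) = (\<integral>\<^sup>+x. \<phi> (ennreal \<bar>f x\<bar>) \<partial>lebesgue_on \<Omega>)"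
    using assms(1) by (intro nn_integral_restrict_space[symmetric]) auto
  also have "\<dots> = (\<integral>\<^sup>+y. \<phi> y \<partial>distr (lebesgue_on \<Omega>) borel (\<lambda>x. ennreal \<bar>f x\<bar>))"
    by (intro nn_integral_distr[symmetric]) auto
  also have "\<dots> = (\<integral>\<^sup>+t. \<phi> (decr_rearr \<Omega> f t) \<partial>restrict_space lborel {0<..<1})"
    unfolding distr_decr_rearr[OF assms(1-3)]
    by (intro nn_integral_distr) (auto intro!: measurable_restrict_space1)
  also have "\<dots> = (\<integral>\<^sup>+t\<in>{0<..<1}. \<phi> (decr_rearr \<Omega> f t) \<partial>lborel)"
    by (intro nn_integral_restrict_space) auto
  finally show ?thesis .
qed

section \<open>Powers, logarithms and integrals of powers\<close>

lemma enn_powr_ennreal: "0 \<le> x \<Longrightarrow> enn_powr (ennreal x) r = ennreal (x powr r)"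
  by (simp add: enn_powr_def)

lemma borel_measurable_enn_powr [measurable]: "(\<lambda>x. enn_powr x r) \<in> borel_measurable borel"
  unfolding enn_powr_def by measurable

text \<open>Translates between bounds on a norm and bounds on the integral under the root. It covers
  infinite x, where both sides fail, so finiteness never has to be checked separately.\<close>

lemma enn_powr_inverse_le_iff:
  assumes "0 < r" "0 \<le> c"
  shows "enn_powr x (1 / r) \<le> ennreal c \<longleftrightarrow> x \<le> ennreal (c powr r)"
proof (cases x)
  case (real y)
  have "y powr (1 / r) \<le> c \<longleftrightarrow> y \<le> c powr r"
  proof
    assume "y powr (1 / r) \<le> c"
    then have "(y powr (1 / r)) powr r \<le> c powr r"
      using assms by (intro powr_mono2) auto
    then show "y \<le> c powr r" using assms real by (simp add: powr_powr)
  next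
    assume "y \<le> c powr r"
    then have "y powr (1 / r) \<le> (c powr r) powr (1 / r)"
      using assms real by (intro powr_mono2) auto
    then show "y powr (1 / r) \<le> c" using assms by (simp add: powr_powr)
  qed
  then show ?thesis using real assms by (simp add: enn_powr_ennreal ennreal_le_iff)
qed (simp add: enn_powr_def top_unique)

lemma add_powr_le:
  fixes a b :: real
  assumes "0 \<le> a" "0 \<le> b" "0 \<le> q"
  shows "(a + b) powr q \<le> 2 powr q * (a powr q + b powr q)"
proof -
  have "(a + b) powr q \<le> (2 * max a b) powr q"
    using assms by (intro powr_mono2) auto
  also have "\<dots> = 2 powr q * max a b powr q"
    using assms by (simp add: powr_mult)
  also have "max a b powr q \<le> a powr q + b powr q"
    by (simp add: max_def)
  finally show ?thesis by simp
qed

text \<open>A power of a logarithm is absorbed by an arbitrarily small power: bounding ln x by a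
  multiple of x^(d/a) leaves x^d after raising to the power a.\<close>

lemma one_plus_ln_powr_le:
  fixes x :: real
  assumes "1 \<le> x" "0 < a" "0 < d"
  shows "(1 + ln x) powr a \<le> (1 + a / d) powr a * x powr d"
proof -
  have "ln x \<le> x powr (d / a) / (d / a)"
    using assms by (intro ln_powr_bound) auto
  moreover have "1 \<le> x powr (d / a)"
    using assms by (intro ge_one_powr_ge_zero) auto
  ultimately have "1 + ln x \<le> (1 + a / d) * x powr (d / a)"
    by (simp add: algebra_simps)
  then have "(1 + ln x) powr a \<le> ((1 + a / d) * x powr (d / a)) powr a"
    using assms by (intro powr_mono2) auto
  also have "\<dots> = (1 + a / d) powr a * x powr d"
    using assms by (simp add: powr_mult powr_powr)
  finally show ?thesis .
qed

text \<open>Separates the logarithmic weight at r/2 into the weight at s and an error that depends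
  on s/r only. The left side is 1 plus three nonnegative terms, hence at most the product of the
  three factors obtained by adding 1 to each.\<close>

lemma one_minus_ln_half_le:
  fixes r s :: real
  assumes "0 < r" "r \<le> s" "s \<le> 1"
  shows "0 < 1 - ln (r / 2)" "1 - ln (r / 2) \<le> (1 + ln 2) * (1 - ln s) * (1 + ln (s / r))"
proof -
  have *: "1 - ln (r / 2) = 1 + ln 2 + (- ln s) + ln (s / r)"
    using assms by (simp add: ln_div)
  have nn: "0 \<le> ln (2::real)" "0 \<le> - ln s" "0 \<le> ln (s / r)"
    using assms by auto
  then show "0 < 1 - ln (r / 2)" unfolding * by linarith
  have "1 + a + b + c \<le> (1 + a) * (1 + b) * (1 + c)" if "0 \<le> a" "0 \<le> b" "0 \<le> c" for a b c :: real
  proof -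
    have "0 \<le> a * b + a * c + b * c + a * b * c" using that by simp
    then show ?thesis by (simp add: algebra_simps)
  qed
  from this[OF nn] show "1 - ln (r / 2) \<le> (1 + ln 2) * (1 - ln s) * (1 + ln (s / r))"
    unfolding * by simp
qed

lemma nn_integral_powr_0:
  fixes s a :: real
  assumes "-1 < a" "0 \<le> s"
  shows "(\<integral>\<^sup>+r\<in>{0<..<s}. ennreal (r powr a) \<partial>lborel) \<le> ennreal (s powr (a + 1) / (a + 1))"
proof -
  have "(\<integral>\<^sup>+r\<in>{0<..<s}. ennreal (r powr a) \<partial>lborel) \<le> (\<integral>\<^sup>+r\<in>{0..s}. ennreal (r powr a) \<partial>lborel)"
    by (intro nn_integral_mono) (auto split: split_indicator)
  also have "\<dots> = ennreal (s powr (a + 1) / (a + 1))"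
    by (intro nn_integral_has_integral_lebesgue' has_integral_powr_from_0 assms) auto
  finally show ?thesis .
qed

lemma nn_integral_powr_tail:
  fixes s a :: real
  assumes "a < -1" "0 < s"
  shows "(\<integral>\<^sup>+r\<in>{s<..<1}. ennreal (r powr a) \<partial>lborel) \<le> ennreal (s powr (a + 1) / (- a - 1))"
proof -
  have "(\<integral>\<^sup>+r\<in>{s<..<1}. ennreal (r powr a) \<partial>lborel) \<le> (\<integral>\<^sup>+r\<in>{s..}. ennreal (r powr a) \<partial>lborel)"
    by (intro nn_integral_mono) (auto split: split_indicator)
  also have "\<dots> = ennreal (- (s powr (a + 1)) / (a + 1))"
    by (intro nn_integral_has_integral_lebesgue' has_integral_powr_to_inf assms) auto
  also have "- (s powr (a + 1)) / (a + 1) = s powr (a + 1) / (- a - 1)"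
    using assms by (simp add: field_simps)
  finally show ?thesis .
qed

section \<open>The rearrangement as a real-valued function, and the norms in terms of it\<close>

locale unit_volume =
  fixes \<Omega> :: "'a::euclidean_space set"
  assumes meas: "\<Omega> \<in> sets lebesgue" and vol: "emeasure lebesgue \<Omega> = 1"
begin

abbreviation "mfun \<equiv> borel_measurable (lebesgue_on \<Omega>)"

text \<open>At positive arguments nothing is lost, since the rearrangement is finite there; at other
  arguments it may be infinite, and \<open>enn2real\<close> then gives 0.\<close>

definition rearr :: "('a \<Rightarrow> real) \<Rightarrow> real \<Rightarrow> real" where
  "rearr f t = enn2real (decr_rearr \<Omega> f t)"

lemma rearr_nonneg [simp]: "0 \<le> rearr f t"
  by (simp add: rearr_def)

lemma decr_rearr_eq: "f \<in> mfun \<Longrightarrow> 0 < t \<Longrightarrow> decr_rearr \<Omega> f t = ennreal (rearr f t)"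
  using decr_rearr_less_top[OF meas] vol by (simp add: rearr_def)

lemma borel_measurable_rearr [measurable (raw)]: "f \<in> mfun \<Longrightarrow> rearr f \<in> borel_measurable borel"
  using borel_measurable_decr_rearr[OF meas] unfolding rearr_def[abs_def] by measurable

lemma rearr_antimono:
  assumes "f \<in> mfun" "0 < t" "t \<le> t'"
  shows "rearr f t' \<le> rearr f t"
proof -
  have "ennreal (rearr f t') \<le> ennreal (rearr f t)"
    using decr_rearr_antimono[OF assms(3)] assms by (simp flip: decr_rearr_eq)
  then show ?thesis by simp
qed

lemma rearr_le_iff:
  assumes "f \<in> mfun" "0 < t" "0 \<le> s"
  shows "rearr f t \<le> s \<longleftrightarrow> distrib_fun \<Omega> f s \<le> ennreal t"
  using decr_rearr_le_iff[OF meas assms(1,3), of t] assms by (simp add: decr_rearr_eq ennreal_le_iff)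

text \<open>Where \<bar>f\<bar> exceeds the sum of the two heights, \<bar>g\<bar> or \<bar>h\<bar>
  exceeds its own height, and each of these events has measure at most t/2.\<close>

lemma rearr_add_le:
  assumes "f \<in> mfun" "g \<in> mfun" "h \<in> mfun" "\<forall>x\<in>\<Omega>. f x = g x + h x" "0 < t"
  shows "rearr f t \<le> rearr g (t / 2) + rearr h (t / 2)"
proof -
  let ?a = "rearr g (t / 2)" and ?b = "rearr h (t / 2)"
  have "distrib_fun \<Omega> f (?a + ?b) \<le> emeasure lebesgue ({x\<in>\<Omega>. ?a < \<bar>g x\<bar>} \<union> {x\<in>\<Omega>. ?b < \<bar>h x\<bar>})"
    unfolding distrib_fun_def
    using superlevel_measurable[OF meas assms(2)] superlevel_measurable[OF meas assms(3)] assms(4)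
    by (intro emeasure_mono) auto
  also have "\<dots> \<le> distrib_fun \<Omega> g ?a + distrib_fun \<Omega> h ?b"
    unfolding distrib_fun_def
    using superlevel_measurable[OF meas assms(2)] superlevel_measurable[OF meas assms(3)]
    by (intro emeasure_subadditive) auto
  also have "\<dots> \<le> ennreal (t / 2) + ennreal (t / 2)"
    using rearr_le_iff[OF assms(2), of "t / 2" ?a] rearr_le_iff[OF assms(3), of "t / 2" ?b] assms(5)
    by (intro add_mono) auto
  also have "\<dots> = ennreal t"
    using assms(5) by (simp flip: ennreal_plus)
  finally show ?thesis
    using rearr_le_iff[OF assms(1,5)] by simp
qed

definition rint :: "('a \<Rightarrow> real) \<Rightarrow> real \<Rightarrow> real \<Rightarrow> real \<Rightarrow> ennreal" where
  "rint f q a b = (\<integral>\<^sup>+t\<in>{a<..<b}. ennreal (rearr f t powr q) \<partial>lborel)"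

lemma nn_integral_rearr:
  assumes "f \<in> mfun" "\<phi> \<in> borel_measurable borel"
  shows "(\<integral>\<^sup>+x\<in>\<Omega>. \<phi> (ennreal \<bar>f x\<bar>) \<partial>lebesgue)
       = (\<integral>\<^sup>+t\<in>{0<..<1}. \<phi> (ennreal (rearr f t)) \<partial>lborel)"
  unfolding nn_integral_decr_rearr[OF meas vol assms]
  by (intro nn_integral_cong) (auto simp: decr_rearr_eq assms(1) split: split_indicator)

lemma Lp_norm_eq:
  assumes "f \<in> mfun"
  shows "Lp_norm \<Omega> p f = enn_powr (rint f p 0 1) (1 / p)"
  using nn_integral_rearr[OF assms, of "\<lambda>x. enn_powr x p"]
  by (simp add: Lp_norm_def enn_powr_ennreal rint_def)

lemma grand_norm_eq:
  assumes "f \<in> mfun"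
  shows "grand_norm \<Omega> q \<alpha> f =
     (SUP t\<in>{0<..<1}. ennreal ((1 - ln t) powr (- \<alpha> / q)) * enn_powr (rint f q t 1) (1 / q))"
proof -
  have "(\<integral>\<^sup>+ s\<in>{t<..<1}. enn_powr (decr_rearr \<Omega> f s) q \<partial>lborel) = rint f q t 1" if "0 < t" for t
    unfolding rint_def using that
    by (intro nn_integral_cong) (auto simp: decr_rearr_eq assms(1) enn_powr_ennreal split: split_indicator)
  then show ?thesis
    unfolding grand_norm_def by (intro SUP_cong) auto
qed

lemma rint_mono: "a' \<le> a \<Longrightarrow> b \<le> b' \<Longrightarrow> rint f q a b \<le> rint f q a' b'"
  unfolding rint_def by (intro nn_integral_mono) (auto split: split_indicator)

text \<open>On (a, b) the rearrangement is at least its value at b. With a = 0 this is Markov's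
  inequality; with a = b/2 it turns tail bounds into pointwise bounds.\<close>

lemma rearr_powr_le_rint:
  assumes "f \<in> mfun" "0 \<le> a" "a < b" "b \<le> c" "0 \<le> q"
  shows "ennreal ((b - a) * rearr f b powr q) \<le> rint f q a c"
proof -
  have "ennreal ((b - a) * rearr f b powr q) = (\<integral>\<^sup>+t\<in>{a<..<b}. ennreal (rearr f b powr q) \<partial>lborel)"
    using assms by (subst nn_integral_cmult_indicator) (auto simp: mult.commute simp flip: ennreal_mult)
  also have "\<dots> \<le> rint f q a b"
    unfolding rint_def using assms
    by (intro nn_integral_mono) (auto split: split_indicator intro!: powr_mono2 rearr_antimono)
  also have "\<dots> \<le> rint f q a c"
    using assms by (intro rint_mono) auto
  finally show ?thesis .
qed

section \<open>Lower bound for the K-functional by tail integrals\<close>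

text \<open>Split f_*(r) into g_*(r/2) + h_*(r/2). Markov's inequality bounds the q-th power of the
  first term by a multiple of A^q r^(-q/p), whose integral over (s, 1) is of order s^(1 - q/p)
  because q/p > 1. The second term is handled by rescaling.\<close>

lemma rint_tail_le:
  assumes f: "f \<in> mfun" "g \<in> mfun" "h \<in> mfun" "\<forall>x\<in>\<Omega>. f x = g x + h x"
    and pq: "0 < p" "p < q" and s: "0 < s" "s < 1"
    and A: "0 \<le> A" "Lp_norm \<Omega> p g \<le> ennreal A" and B: "0 \<le> B" "Lp_norm \<Omega> q h \<le> ennreal B"
  shows "rint f q s 1 \<le> ennreal (2 powr q * (2 powr (q / p) / (q / p - 1) + 2) *
           ((A * s powr (1 / q - 1 / p)) powr q + B powr q))"
proof -
  note [measurable] = f(1-3)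
  have q: "0 < q" using pq by simp
  have g: "rint g p 0 1 \<le> ennreal (A powr p)"
    using A pq by (simp add: Lp_norm_eq f enn_powr_inverse_le_iff)
  have h: "rint h q 0 1 \<le> ennreal (B powr q)"
    using B q by (simp add: Lp_norm_eq f enn_powr_inverse_le_iff)
  have g_le: "rearr g (r / 2) powr q \<le> A powr q * 2 powr (q / p) * r powr (- q / p)"
    if r: "0 < r" "r < 1" for r
  proof -
    have "ennreal ((r / 2 - 0) * rearr g (r / 2) powr p) \<le> ennreal (A powr p)"
      by (rule order_trans[OF rearr_powr_le_rint g]) (use r pq f in auto)
    then have "rearr g (r / 2) powr p \<le> A powr p * (2 / r)"
      using r by (simp add: field_simps)
    then have "(rearr g (r / 2) powr p) powr (q / p) \<le> (A powr p * (2 / r)) powr (q / p)"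
      using pq by (intro powr_mono2) auto
    also have "\<dots> = A powr q * 2 powr (q / p) * r powr (- q / p)"
      using pq r A by (simp add: powr_mult powr_powr powr_divide powr_minus_divide)
    finally show ?thesis using pq by (simp add: powr_powr)
  qed
  have h_le: "(\<integral>\<^sup>+r\<in>{s<..<1}. ennreal (rearr h (r / 2) powr q) \<partial>lborel) \<le> ennreal (2 * B powr q)"
  proof -
    \<comment> \<open>The range is enlarged from (s, 1) to (0, 2), which is the preimage of (0, 1)
      under halving; the change of variables then costs a factor 2.\<close>
    have "(\<integral>\<^sup>+r\<in>{s<..<1}. ennreal (rearr h (r / 2) powr q) \<partial>lborel)
       \<le> (\<integral>\<^sup>+r. ennreal (rearr h (0 + (1/2) * r) powr q) * indicator {0<..<1} (0 + (1/2) * r) \<partial>lborel)"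
      using s by (intro nn_integral_mono) (auto split: split_indicator)
    also have "\<dots> = 2 * rint h q 0 1"
    proof -
      have "rint h q 0 1 = ennreal \<bar>1/2\<bar> *
          (\<integral>\<^sup>+r. ennreal (rearr h (0 + (1/2) * r) powr q) * indicator {0<..<1} (0 + (1/2) * r) \<partial>lborel)"
        unfolding rint_def by (rule nn_integral_real_affine) auto
      then have "2 * rint h q 0 1 = (ennreal 2 * ennreal (1/2)) *
          (\<integral>\<^sup>+r. ennreal (rearr h (0 + (1/2) * r) powr q) * indicator {0<..<1} (0 + (1/2) * r) \<partial>lborel)"
        by (simp add: mult.assoc)
      also have "ennreal 2 * ennreal (1/2) = 1"
        by (subst ennreal_mult[symmetric]) auto
      finally show ?thesis by simp
    qed
    also have "\<dots> \<le> 2 * ennreal (B powr q)" using h by (intro mult_left_mono) auto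
    finally show ?thesis by (simp add: ennreal_mult)
  qed
  have "rint f q s 1 \<le> (\<integral>\<^sup>+r\<in>{s<..<1}. ennreal (2 powr q * A powr q * 2 powr (q / p)) * ennreal (r powr (- q / p))
        + ennreal (2 powr q) * ennreal (rearr h (r / 2) powr q) \<partial>lborel)"
    unfolding rint_def
  proof (intro nn_integral_mono)
    fix r :: real
    show "ennreal (rearr f r powr q) * indicator {s<..<1} r \<le>
      (ennreal (2 powr q * A powr q * 2 powr (q / p)) * ennreal (r powr (- q / p))
        + ennreal (2 powr q) * ennreal (rearr h (r / 2) powr q)) * indicator {s<..<1} r"
    proof (cases "r \<in> {s<..<1}")
      case True
      then have r: "0 < r" "r < 1" using s by auto
      have "rearr f r powr q \<le> (rearr g (r / 2) + rearr h (r / 2)) powr q"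
        using r q f by (intro powr_mono2 rearr_add_le) auto
      also have "\<dots> \<le> 2 powr q * (rearr g (r / 2) powr q + rearr h (r / 2) powr q)"
        using q by (intro add_powr_le) auto
      also have "\<dots> \<le> 2 powr q * (A powr q * 2 powr (q / p) * r powr (- q / p) + rearr h (r / 2) powr q)"
        using g_le[OF r] by (intro mult_left_mono) auto
      finally show ?thesis
        using True by (simp add: algebra_simps flip: ennreal_mult ennreal_plus)
    qed simp
  qed
  also have "\<dots> = ennreal (2 powr q * A powr q * 2 powr (q / p)) * (\<integral>\<^sup>+r\<in>{s<..<1}. ennreal (r powr (- q / p)) \<partial>lborel)
        + ennreal (2 powr q) * (\<integral>\<^sup>+r\<in>{s<..<1}. ennreal (rearr h (r / 2) powr q) \<partial>lborel)"
    by (simp add: distrib_right nn_integral_add nn_integral_cmult mult.assoc)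
  also have "\<dots> \<le> ennreal (2 powr q * A powr q * 2 powr (q / p)) * ennreal (s powr (- q / p + 1) / (- (- q / p) - 1))
        + ennreal (2 powr q) * ennreal (2 * B powr q)"
    using pq s by (intro add_mono mult_left_mono nn_integral_powr_tail h_le) (auto simp: field_simps)
  also have "\<dots> = ennreal (2 powr q * (A powr q * s powr (1 - q / p) * (2 powr (q / p) / (q / p - 1)) + 2 * B powr q))"
    using pq by (simp add: algebra_simps flip: ennreal_mult ennreal_plus)
  also have "\<dots> \<le> ennreal (2 powr q * (2 powr (q / p) / (q / p - 1) + 2) *
           ((A * s powr (1 / q - 1 / p)) powr q + B powr q))"
  proof (intro ennreal_leI)
    \<comment> \<open>The exponents agree since 1 - q/p = q (1/q - 1/p); this puts A and B on the
      same footing as q-th powers.\<close>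
    have e: "A powr q * s powr (1 - q / p) = (A * s powr (1 / q - 1 / p)) powr q"
      using q s A by (simp add: powr_mult powr_powr algebra_simps)
    define x y where "x = 2 powr (q / p) / (q / p - 1)" and "y = (A * s powr (1 / q - 1 / p)) powr q"
    have "0 \<le> x" "0 \<le> y" using pq by (auto simp: x_def y_def)
    then have "y * x + 2 * B powr q \<le> (x + 2) * (y + B powr q)"
      by (simp add: algebra_simps)
    then show "2 powr q * (A powr q * s powr (1 - q / p) * (2 powr (q / p) / (q / p - 1)) + 2 * B powr q)
      \<le> 2 powr q * (2 powr (q / p) / (q / p - 1) + 2) * ((A * s powr (1 / q - 1 / p)) powr q + B powr q)"
      unfolding e x_def[symmetric] y_def[symmetric] mult.assoc by (intro mult_left_mono) auto
  qed
  finally show ?thesis .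
qed

text \<open>With t = s^k and k = 1/p - 1/q, the quantity A s^(-k) + B in the tail estimate is
  exactly (A + t B) / t, so it is the cost of the decomposition divided by t.\<close>

lemma K_fun_ge:
  assumes pq: "0 < p" "p < q"
  obtains C where "0 < C"
    "\<And>f s. f \<in> mfun \<Longrightarrow> 0 < s \<Longrightarrow> s < 1 \<Longrightarrow>
       ennreal (s powr (1 / p - 1 / q) / C) * enn_powr (rint f q s 1) (1 / q)
         \<le> K_fun \<Omega> p q f (s powr (1 / p - 1 / q))"
proof -
  define D where "D = 2 powr q * (2 powr (q / p) / (q / p - 1) + 2)"
  \<comment> \<open>Here D is the constant of \<open>rint_tail_le\<close>; the factor 2 comes from
    X^q + B^q \<le> 2 (X + B)^q.\<close>
  define C where "C = (2 * D) powr (1 / q)"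
  define k where "k = 1 / p - 1 / q"
  have q: "0 < q" using pq by simp
  have D: "0 < D" using pq by (auto simp: D_def intro!: add_nonneg_pos mult_pos_pos)
  then have C: "0 < C" by (simp add: C_def)
  have Cq: "C powr q = 2 * D" using q D by (simp add: C_def powr_powr)
  have "ennreal (s powr k / C) * enn_powr (rint f q s 1) (1 / q) \<le> K_fun \<Omega> p q f (s powr k)"
    if f: "f \<in> mfun" and s: "0 < s" "s < 1" for f s
    unfolding K_fun_def
  proof (rule Inf_greatest, safe)
    fix g h assume gh: "g \<in> mfun" "h \<in> mfun" "\<forall>x\<in>\<Omega>. f x = g x + h x"
    show "ennreal (s powr k / C) * enn_powr (rint f q s 1) (1 / q)
       \<le> Lp_norm \<Omega> p g + ennreal (s powr k) * Lp_norm \<Omega> q h"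
    proof (cases "Lp_norm \<Omega> p g = top \<or> Lp_norm \<Omega> q h = top")
      case True
      then show ?thesis using s by (auto simp: ennreal_mult_top)
    next
      case False
      then obtain A B where A: "0 \<le> A" "Lp_norm \<Omega> p g = ennreal A"
        and B: "0 \<le> B" "Lp_norm \<Omega> q h = ennreal B"
        by (metis ennreal_cases)
      define X where "X = A * s powr (- k)"
      have X: "0 \<le> X" using A by (simp add: X_def)
      have le: "X powr q \<le> (X + B) powr q" "B powr q \<le> (X + B) powr q"
        using X B q by (auto intro!: powr_mono2)
      have "rint f q s 1 \<le> ennreal (D * (X powr q + B powr q))"
        using rint_tail_le[OF f gh pq s, of A B] A B by (simp add: D_def X_def k_def)
      also have "\<dots> \<le> ennreal (D * (2 * (X + B) powr q))"
        using le D by (intro ennreal_leI mult_left_mono) auto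
      also have "D * (2 * (X + B) powr q) = (C * (X + B)) powr q"
        using C X B by (simp add: powr_mult Cq)
      finally have "enn_powr (rint f q s 1) (1 / q) \<le> ennreal (C * (X + B))"
        using X B C q by (subst enn_powr_inverse_le_iff) auto
      then have "ennreal (s powr k / C) * enn_powr (rint f q s 1) (1 / q)
          \<le> ennreal (s powr k / C) * ennreal (C * (X + B))"
        by (rule mult_left_mono) simp
      also have "\<dots> = ennreal (s powr k * X + s powr k * B)"
        using C X B by (simp add: field_simps flip: ennreal_mult)
      also have "s powr k * X = A"
        using s by (simp add: X_def powr_minus)
      finally show ?thesis using A B by (simp add: ennreal_mult)
    qed
  qed
  with C show ?thesis unfolding k_def by (rule that)
qed

text \<open>Each s is tested against t = s^k. From p \<ge> 1 comes k \<le> 1, hence ln s \<le> ln t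
  < 0, and the decreasing logarithmic weight at t dominates the one at s.\<close>

lemma grand_le_interp:
  assumes pq: "1 \<le> p" "p < q" and a: "0 < \<alpha>"
  obtains c where "0 < c"
    "\<And>f. f \<in> mfun \<Longrightarrow> ennreal c * grand_norm \<Omega> q \<alpha> f \<le> interp_norm \<Omega> p q (- \<alpha> / q) f"
proof -
  define k where "k = 1 / p - 1 / q"
  have "1 / p \<le> 1" "0 < 1 / q" "1 / q < 1 / p" using pq by (auto simp: field_simps)
  then have k: "0 < k" "k \<le> 1" unfolding k_def by linarith+
  have "0 < p" using pq by simp
  from K_fun_ge[OF this pq(2)] obtain C where C: "0 < C"
    and le: "\<And>f s. f \<in> mfun \<Longrightarrow> 0 < s \<Longrightarrow> s < 1 \<Longrightarrow>
       ennreal (s powr k / C) * enn_powr (rint f q s 1) (1 / q) \<le> K_fun \<Omega> p q f (s powr k)"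
    unfolding k_def by blast
  have "ennreal (1 / C) * grand_norm \<Omega> q \<alpha> f \<le> interp_norm \<Omega> p q (- \<alpha> / q) f" if f: "f \<in> mfun" for f
    unfolding grand_norm_eq[OF f] SUP_mult_left_ennreal
  proof (rule SUP_least)
    fix s :: real assume "s \<in> {0<..<1}"
    then have s: "0 < s" "s < 1" by auto
    define t where "t = s powr k"
    define N where "N = enn_powr (rint f q s 1) (1 / q)"
    have t: "0 < t" "t < 1" "ln t = k * ln s"
      using s k powr_less_mono2[of k s 1] by (auto simp: t_def ln_powr)
    have "ln s \<le> ln t" "ln t < 0"
      using s k t by (simp_all add: mult_le_cancel_right2 mult_pos_neg)
    then have "0 < 1 - ln t" "1 - ln t \<le> 1 - ln s" by linarith+
    moreover have "- \<alpha> / q \<le> 0" using pq a by simp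
    ultimately have w: "(1 - ln s) powr (- \<alpha> / q) \<le> (1 - ln t) powr (- \<alpha> / q)"
      by (intro powr_mono2')
    have "ennreal (1 / C) * (ennreal ((1 - ln s) powr (- \<alpha> / q)) * N)
        \<le> ennreal (1 / C) * (ennreal ((1 - ln t) powr (- \<alpha> / q)) * N)"
      using w by (intro mult_left_mono mult_right_mono ennreal_leI) auto
    also have "\<dots> = ennreal (t powr -1 * (1 - ln t) powr (- \<alpha> / q)) * (ennreal (t / C) * N)"
    proof -
      have "1 / C * (1 - ln t) powr (- \<alpha> / q) = t powr -1 * (1 - ln t) powr (- \<alpha> / q) * (t / C)"
        using t(1) by (simp add: powr_minus_divide)
      then have "ennreal (1 / C) * ennreal ((1 - ln t) powr (- \<alpha> / q))
          = ennreal (t powr -1 * (1 - ln t) powr (- \<alpha> / q)) * ennreal (t / C)"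
        using C t(1) by (simp only: ennreal_mult[symmetric] powr_ge_zero divide_nonneg_pos
          zero_le_one less_imp_le mult_nonneg_nonneg)
      then show ?thesis by (simp only: mult.assoc[symmetric])
    qed
    also have "\<dots> \<le> ennreal (t powr -1 * (1 - ln t) powr (- \<alpha> / q)) * K_fun \<Omega> p q f t"
      using le[OF f s] by (intro mult_left_mono) (auto simp: t_def N_def)
    also have "\<dots> \<le> interp_norm \<Omega> p q (- \<alpha> / q) f"
      unfolding interp_norm_def using t by (intro SUP_upper) auto
    finally show "ennreal (1 / C) * (ennreal ((1 - ln s) powr (- \<alpha> / q)) * N)
      \<le> interp_norm \<Omega> p q (- \<alpha> / q) f" .
  qed
  with C show ?thesis by (intro that[of "1 / C"]) auto
qed

section \<open>Upper bound for the K-functional by truncation\<close>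

text \<open>The decomposition cuts f at height l = f_*(s): g keeps the values above l in modulus, h
  the rest. Both integrands are functions of \<bar>f\<bar> alone, so equimeasurability applies to
  them directly and the rearrangements of g and h are never computed.\<close>

lemma K_fun_le:
  assumes f: "f \<in> mfun" and pq: "0 < p" "0 < q" and s: "0 < s" "s < 1"
  shows "K_fun \<Omega> p q f t \<le> enn_powr (rint f p 0 s) (1 / p)
           + ennreal t * enn_powr (ennreal (s * rearr f s powr q) + rint f q s 1) (1 / q)"
proof -
  note [measurable] = f
  define l where "l = rearr f s"
  have l: "0 \<le> l" by (simp add: l_def)
  define g where "g x = (if \<bar>f x\<bar> \<le> l then 0 else f x)" for x
  define h where "h x = (if \<bar>f x\<bar> \<le> l then f x else 0)" for x
  have gh: "g \<in> mfun" "h \<in> mfun" unfolding g_def[abs_def] h_def[abs_def] by measurable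
  have mono: "enn_powr x r \<le> enn_powr y r" if xy: "x \<le> y" "0 < r" for x y r
  proof (cases y)
    case (real b)
    then obtain a where a: "0 \<le> a" "x = ennreal a" using xy(1) real by (cases x) (auto simp: top_unique)
    then show ?thesis using that real by (auto simp: enn_powr_ennreal intro!: powr_mono2)
  qed (simp add: enn_powr_def)
  have "(\<integral>\<^sup>+x\<in>\<Omega>. ennreal (\<bar>g x\<bar> powr p) \<partial>lebesgue)
      = (\<integral>\<^sup>+x\<in>\<Omega>. (if ennreal \<bar>f x\<bar> \<le> ennreal l then 0 else enn_powr (ennreal \<bar>f x\<bar>) p) \<partial>lebesgue)"
    using l by (intro nn_integral_cong) (auto simp: g_def enn_powr_ennreal split: split_indicator)
  also have "\<dots> = (\<integral>\<^sup>+t\<in>{0<..<1}. (if ennreal (rearr f t) \<le> ennreal l then 0 else enn_powr (ennreal (rearr f t)) p) \<partial>lborel)"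
    by (rule nn_integral_rearr[OF f]) measurable
  also have "\<dots> \<le> rint f p 0 s"
    unfolding rint_def
  proof (intro nn_integral_mono)
    fix t :: real
    \<comment> \<open>From s onwards the integrand vanishes, which leaves only the head
      integral.\<close>
    have "rearr f t \<le> l" if "s \<le> t"
      unfolding l_def using that s by (intro rearr_antimono f)
    then show "(if ennreal (rearr f t) \<le> ennreal l then 0 else enn_powr (ennreal (rearr f t)) p) * indicator {0<..<1} t
      \<le> ennreal (rearr f t powr p) * indicator {0<..<s} t"
      using l by (cases "t < s") (simp_all add: enn_powr_ennreal ennreal_le_iff indicator_def)
  qed
  finally have gp: "Lp_norm \<Omega> p g \<le> enn_powr (rint f p 0 s) (1 / p)"
    unfolding Lp_norm_def using pq by (intro mono) auto
  have "(\<integral>\<^sup>+x\<in>\<Omega>. ennreal (\<bar>h x\<bar> powr q) \<partial>lebesgue)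
      = (\<integral>\<^sup>+x\<in>\<Omega>. (if ennreal \<bar>f x\<bar> \<le> ennreal l then enn_powr (ennreal \<bar>f x\<bar>) q else 0) \<partial>lebesgue)"
    using l by (intro nn_integral_cong) (auto simp: h_def enn_powr_ennreal split: split_indicator)
  also have "\<dots> = (\<integral>\<^sup>+t\<in>{0<..<1}. (if ennreal (rearr f t) \<le> ennreal l then enn_powr (ennreal (rearr f t)) q else 0) \<partial>lborel)"
    by (rule nn_integral_rearr[OF f]) measurable
  also have "\<dots> \<le> (\<integral>\<^sup>+t. ennreal (l powr q) * indicator {0<..s} t + ennreal (rearr f t powr q) * indicator {s<..<1} t \<partial>lborel)"
  proof (intro nn_integral_mono)
    fix t :: real
    show "(if ennreal (rearr f t) \<le> ennreal l then enn_powr (ennreal (rearr f t)) q else 0) * indicator {0<..<1} t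
      \<le> ennreal (l powr q) * indicator {0<..s} t + ennreal (rearr f t powr q) * indicator {s<..<1} t"
      \<comment> \<open>Up to s the integrand survives only where the rearrangement is at most l, so
        it is bounded by l^q there; this gives the term s l^q.\<close>
      using l pq by (cases "t \<le> s") (simp_all add: enn_powr_ennreal ennreal_le_iff indicator_def powr_mono2)
  qed
  also have "\<dots> = ennreal (s * rearr f s powr q) + rint f q s 1"
  proof -
    have "(\<integral>\<^sup>+t. ennreal (l powr q) * indicator {0<..s} t \<partial>lborel) = ennreal (s * rearr f s powr q)"
      using s by (subst nn_integral_cmult_indicator) (auto simp: l_def mult.commute simp flip: ennreal_mult)
    then show ?thesis
      unfolding rint_def by (subst nn_integral_add) auto
  qed
  finally have hq: "Lp_norm \<Omega> q h \<le> enn_powr (ennreal (s * rearr f s powr q) + rint f q s 1) (1 / q)"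
    unfolding Lp_norm_def using pq by (intro mono) auto
  have "K_fun \<Omega> p q f t \<le> Lp_norm \<Omega> p g + ennreal t * Lp_norm \<Omega> q h"
  proof -
    have "\<forall>x\<in>\<Omega>. f x = g x + h x" by (simp add: g_def h_def)
    with gh show ?thesis unfolding K_fun_def by (blast intro: Inf_lower)
  qed
  also have "\<dots> \<le> enn_powr (rint f p 0 s) (1 / p)
           + ennreal t * enn_powr (ennreal (s * rearr f s powr q) + rint f q s 1) (1 / q)"
    using gp hq by (intro add_mono mult_left_mono) auto
  finally show ?thesis .
qed

text \<open>The hypothesis on G says that the grand norm is at most G. Monotonicity on (r/2, r)
  turns it into a pointwise bound on f_*(r)^p by r^(-p/q) times a power of the logarithm at r/2.
  That logarithm is the one at s up to a small power of s/r, and p/q < 1 keeps the result integrable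
  at 0.\<close>

lemma rint_head_le:
  assumes pq: "0 < p" "p < q" and a: "0 < \<alpha>"
  obtains C where "0 \<le> C"
    "\<And>f G s. f \<in> mfun \<Longrightarrow> 0 \<le> G \<Longrightarrow> 0 < s \<Longrightarrow> s < 1 \<Longrightarrow>
       (\<And>r. 0 < r \<Longrightarrow> r < 1 \<Longrightarrow> rint f q r 1 \<le> ennreal (G powr q * (1 - ln r) powr \<alpha>)) \<Longrightarrow>
       rint f p 0 s \<le> ennreal (C * (G powr p * (1 - ln s) powr (\<alpha> * p / q) * s powr (1 - p / q)))"
proof -
  \<comment> \<open>The exponent d is half of the room between b and 1, so that b + d < 1 and 1 - (b
    + d) = d.\<close>
  define b e d where "b = p / q" and "e = \<alpha> * p / q" and "d = (1 - b) / 2"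
  define M where "M = 2 powr b * (1 + ln 2) powr e * (1 + e / d) powr e"
  have b: "0 < b" "b < 1" and e: "0 < e" using pq a by (auto simp: b_def e_def)
  then have d: "0 < d" by (simp add: d_def)
  have M: "0 \<le> M" by (simp add: M_def)
  have "rint f p 0 s \<le> ennreal (M / d * (G powr p * (1 - ln s) powr e * s powr (1 - b)))"
    if f: "f \<in> mfun" and G: "0 \<le> G" and s: "0 < s" "s < 1"
      and le: "\<And>r. 0 < r \<Longrightarrow> r < 1 \<Longrightarrow> rint f q r 1 \<le> ennreal (G powr q * (1 - ln r) powr \<alpha>)" for f G s
  proof -
    define L where "L = 1 - ln s"
    have L: "1 \<le> L" using s by (simp add: L_def)
    have pt: "rearr f r powr p \<le> M * G powr p * L powr e * s powr d * r powr (- (b + d))"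
      if r: "0 < r" "r < s" for r
    proof -
      define y where "y = 1 - ln (r / 2)"
      have y: "0 < y" "y \<le> (1 + ln 2) * L * (1 + ln (s / r))"
        using one_minus_ln_half_le[of r s] r s by (auto simp: y_def L_def)
      have "ennreal ((r - r / 2) * rearr f r powr q) \<le> ennreal (G powr q * y powr \<alpha>)"
        by (rule order_trans[OF rearr_powr_le_rint le[of "r / 2", folded y_def]]) (use r s pq f in auto)
      then have "rearr f r powr q \<le> (2 / r) * (G powr q * y powr \<alpha>)"
        using r by (simp add: field_simps)
      then have "(rearr f r powr q) powr b \<le> ((2 / r) * (G powr q * y powr \<alpha>)) powr b"
        using b by (intro powr_mono2) auto
      also have "\<dots> = (2 powr b * r powr - b) * (G powr p * y powr e)"
        using r pq y by (simp add: powr_mult powr_powr powr_divide powr_minus_divide b_def e_def)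
      also have "(rearr f r powr q) powr b = rearr f r powr p"
        using pq by (simp add: powr_powr b_def)
      finally have 1: "rearr f r powr p \<le> (2 powr b * r powr - b) * (G powr p * y powr e)" .
      have "y powr e \<le> ((1 + ln 2) * L * (1 + ln (s / r))) powr e"
        using y e by (intro powr_mono2) auto
      also have "\<dots> = (1 + ln 2) powr e * L powr e * (1 + ln (s / r)) powr e"
        using L r by (simp add: powr_mult)
      also have "\<dots> \<le> (1 + ln 2) powr e * L powr e * ((1 + e / d) powr e * (s / r) powr d)"
        using r e d by (intro mult_left_mono one_plus_ln_powr_le) auto
      finally have "(2 powr b * r powr - b) * (G powr p * y powr e) \<le> (2 powr b * r powr - b) *
          (G powr p * ((1 + ln 2) powr e * L powr e * ((1 + e / d) powr e * (s / r) powr d)))"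
        by (intro mult_left_mono) auto
      also have "\<dots> = M * G powr p * L powr e * s powr d * (r powr - b * r powr - d)"
        using r s by (simp add: M_def powr_divide powr_minus_divide)
      also have "r powr - b * r powr - d = r powr (- (b + d))"
        by (simp flip: powr_add)
      finally show ?thesis using 1 by linarith
    qed
    have "rint f p 0 s \<le> (\<integral>\<^sup>+r. ennreal (M * G powr p * L powr e * s powr d) *
        (ennreal (r powr (- (b + d))) * indicator {0<..<s} r) \<partial>lborel)"
      unfolding rint_def
    proof (intro nn_integral_mono)
      fix r :: real
      show "ennreal (rearr f r powr p) * indicator {0<..<s} r \<le>
          ennreal (M * G powr p * L powr e * s powr d) * (ennreal (r powr (- (b + d))) * indicator {0<..<s} r)"
        using pt[of r] by (cases "r \<in> {0<..<s}") (simp_all add: ennreal_leI flip: ennreal_mult'')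
    qed
    also have "\<dots> = ennreal (M * G powr p * L powr e * s powr d) *
        (\<integral>\<^sup>+r\<in>{0<..<s}. ennreal (r powr (- (b + d))) \<partial>lborel)"
      by (intro nn_integral_cmult) measurable
    also have "\<dots> \<le> ennreal (M * G powr p * L powr e * s powr d) *
        ennreal (s powr (- (b + d) + 1) / (- (b + d) + 1))"
      using s b by (intro mult_left_mono nn_integral_powr_0) (auto simp: d_def field_simps)
    also have "- (b + d) + 1 = d" by (simp add: d_def field_simps)
    also have "ennreal (M * G powr p * L powr e * s powr d) * ennreal (s powr d / d)
      = ennreal (M / d * (G powr p * L powr e * (s powr d * s powr d)))"
      using M d by (simp flip: ennreal_mult)
    \<comment> \<open>One factor comes from (s/r)^d, the other from integrating r^(-(b + d)) over
      (0, s).\<close>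
    also have "s powr d * s powr d = s powr (1 - b)"
      by (simp flip: powr_add add: d_def)
    finally show ?thesis by (simp add: L_def)
  qed
  moreover have "0 \<le> M / d" using M d by simp
  ultimately show ?thesis unfolding e_def b_def by (intro that) auto
qed

text \<open>With s = t^(1/k), both terms of \<open>K_fun_le\<close> are of order G t (1 - ln
  s)^(\<alpha>/q). Dividing by t and by the logarithmic weight at t leaves a multiple of the grand
  norm G.\<close>

lemma interp_le_grand:
  assumes pq: "1 \<le> p" "p < q" and a: "0 < \<alpha>"
  obtains C where "0 < C"
    "\<And>f. f \<in> mfun \<Longrightarrow> interp_norm \<Omega> p q (- \<alpha> / q) f \<le> ennreal C * grand_norm \<Omega> q \<alpha> f"
proof -
  define k where "k = 1 / p - 1 / q"
  have "1 / p \<le> 1" "0 < 1 / q" "1 / q < 1 / p" using pq by (auto simp: field_simps)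
  then have k: "0 < k" "k \<le> 1" unfolding k_def by linarith+
  have p: "0 < p" and q: "0 < q" using pq by auto
  obtain C1 where C1: "0 \<le> C1" and head:
    "\<And>f G s. f \<in> mfun \<Longrightarrow> 0 \<le> G \<Longrightarrow> 0 < s \<Longrightarrow> s < 1 \<Longrightarrow>
       (\<And>r. 0 < r \<Longrightarrow> r < 1 \<Longrightarrow> rint f q r 1 \<le> ennreal (G powr q * (1 - ln r) powr \<alpha>)) \<Longrightarrow>
       rint f p 0 s \<le> ennreal (C1 * (G powr p * (1 - ln s) powr (\<alpha> * p / q) * s powr (1 - p / q)))"
    using rint_head_le[OF p pq(2) a] by blast
  \<comment> \<open>The 3 adds a factor 2 from the pointwise bound at s and 1 from the tail; 1 + ln
    2 is the price for the logarithm at s/2 instead of s. In C below, the power of 1/k pays for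
    passing from ln s to ln t = k ln s.\<close>
  define C2 where "C2 = 3 powr (1 / q) * (1 + ln 2) powr (\<alpha> / q)"
  define C where "C = (C1 powr (1 / p) + C2) * (1 / k) powr (\<alpha> / q)"
  have "0 < 1 + ln (2::real)" by (intro add_pos_pos) auto
  then have C2: "0 < C2" by (simp add: C2_def)
  then have C: "0 < C" using k by (auto simp: C_def intro!: mult_pos_pos add_nonneg_pos)
  have "interp_norm \<Omega> p q (- \<alpha> / q) f \<le> ennreal C * grand_norm \<Omega> q \<alpha> f" if f: "f \<in> mfun" for f
  proof (cases "grand_norm \<Omega> q \<alpha> f")
    case top
    then show ?thesis using C by (simp add: ennreal_mult_top)
  next
    case (real G)
    have tail: "rint f q r 1 \<le> ennreal (G powr q * (1 - ln r) powr \<alpha>)" if r: "0 < r" "r < 1" for r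
    proof -
      have w: "0 < 1 - ln r" using r ln_less_zero[of r] by linarith
      have le: "ennreal ((1 - ln r) powr (- \<alpha> / q)) * enn_powr (rint f q r 1) (1 / q) \<le> ennreal G"
        unfolding real(2)[symmetric] grand_norm_eq[OF f] using r by (intro SUP_upper) auto
      have "enn_powr (rint f q r 1) (1 / q) = ennreal ((1 - ln r) powr (\<alpha> / q)) *
          (ennreal ((1 - ln r) powr (- \<alpha> / q)) * enn_powr (rint f q r 1) (1 / q))"
        using w by (simp flip: mult.assoc ennreal_mult powr_add)
      also have "\<dots> \<le> ennreal ((1 - ln r) powr (\<alpha> / q)) * ennreal G"
        using le by (rule mult_left_mono) simp
      also have "\<dots> = ennreal (G * (1 - ln r) powr (\<alpha> / q))"
        using real by (simp add: mult.commute flip: ennreal_mult)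
      finally have "rint f q r 1 \<le> ennreal ((G * (1 - ln r) powr (\<alpha> / q)) powr q)"
        using real q by (subst (asm) enn_powr_inverse_le_iff) auto
      then show ?thesis using real q w by (simp add: powr_mult powr_powr)
    qed
    show ?thesis
      unfolding interp_norm_def
    proof (rule SUP_least)
      fix t :: real assume "t \<in> {0<..<1}"
      then have t: "0 < t" "t < 1" by auto
      define s where "s = t powr (1 / k)"
      have s: "0 < s" "s < 1"
        using t k powr_less_mono2[of "1 / k" t 1] by (auto simp: s_def)
      have ts: "s powr k = t" using t k by (simp add: s_def powr_powr)
      define L where "L = 1 - ln s"
      have L: "1 \<le> L" using s by (simp add: L_def)
      have lnt: "ln t \<le> 0" using t by simp
      have "ln s = ln t / k" using t by (simp add: s_def ln_powr)
      \<comment> \<open>Uses 1 \<le> 1/k.\<close>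
      then have "L \<le> (1 / k) * (1 - ln t)"
        using k by (simp add: L_def field_simps)
      then have "L powr (\<alpha> / q) \<le> ((1 / k) * (1 - ln t)) powr (\<alpha> / q)"
        using L a q by (intro powr_mono2) auto
      then have Lt: "L powr (\<alpha> / q) \<le> (1 / k) powr (\<alpha> / q) * (1 - ln t) powr (\<alpha> / q)"
        using k lnt by (subst (asm) powr_mult) auto
      \<comment> \<open>Because k p = 1 - p/q, the power of s in the head estimate is t^p, and its
        p-th root supplies the factor t.\<close>
      have kp: "s powr (1 - p / q) = t powr p"
        using p q unfolding ts[symmetric] by (simp add: powr_powr k_def algebra_simps)
      have "rint f p 0 s \<le> ennreal (C1 * (G powr p * L powr (\<alpha> * p / q) * t powr p))"
        using head[OF f real(1) s tail] by (simp add: L_def kp)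
      also have "C1 * (G powr p * L powr (\<alpha> * p / q) * t powr p)
         = (C1 powr (1 / p) * (G * L powr (\<alpha> / q) * t)) powr p"
        using C1 real(1) t p by (simp add: powr_mult powr_powr)
      finally have 1: "enn_powr (rint f p 0 s) (1 / p) \<le> ennreal (C1 powr (1 / p) * (G * L powr (\<alpha> / q) * t))"
        using C1 real(1) t p by (subst enn_powr_inverse_le_iff) auto
      define y where "y = 1 - ln (s / 2)"
      have y: "0 < y" "y \<le> (1 + ln 2) * L"
        using one_minus_ln_half_le[of s s] s by (auto simp: y_def L_def)
      \<comment> \<open>The rearrangement at s is controlled by the tail that starts at s/2; the
        same tail also dominates the one that starts at s.\<close>
      have "ennreal ((s - s / 2) * rearr f s powr q) \<le> rint f q (s / 2) 1"
        using s q by (intro rearr_powr_le_rint f) auto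
      also have h: "rint f q (s / 2) 1 \<le> ennreal (G powr q * y powr \<alpha>)"
        using tail[of "s / 2"] s by (simp add: y_def)
      finally have "s * rearr f s powr q \<le> 2 * (G powr q * y powr \<alpha>)"
        by (simp add: field_simps)
      moreover have "rint f q s 1 \<le> ennreal (G powr q * y powr \<alpha>)"
        using s by (intro order_trans[OF rint_mono h]) auto
      ultimately have "ennreal (s * rearr f s powr q) + rint f q s 1
          \<le> ennreal (2 * (G powr q * y powr \<alpha>)) + ennreal (G powr q * y powr \<alpha>)"
        by (intro add_mono ennreal_leI)
      also have "\<dots> = ennreal (3 * (G powr q * y powr \<alpha>))"
        by (simp flip: ennreal_plus)
      also have "\<dots> \<le> ennreal (3 * (G powr q * ((1 + ln 2) * L) powr \<alpha>))"
        using y a by (intro ennreal_leI mult_left_mono powr_mono2) auto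
      also have "3 * (G powr q * ((1 + ln 2) * L) powr \<alpha>) = (C2 * (G * L powr (\<alpha> / q))) powr q"
        using real(1) L q by (simp add: C2_def powr_mult powr_powr)
      finally have 2: "enn_powr (ennreal (s * rearr f s powr q) + rint f q s 1) (1 / q)
          \<le> ennreal (C2 * (G * L powr (\<alpha> / q)))"
        using C2 real(1) q by (subst enn_powr_inverse_le_iff) auto
      have "K_fun \<Omega> p q f t \<le> ennreal (C1 powr (1 / p) * (G * L powr (\<alpha> / q) * t))
          + ennreal t * ennreal (C2 * (G * L powr (\<alpha> / q)))"
        by (rule order_trans[OF K_fun_le[OF f p q s]]) (intro add_mono mult_left_mono 1 2, simp)
      also have "\<dots> = ennreal ((C1 powr (1 / p) + C2) * G * t * L powr (\<alpha> / q))"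
        using C2 real(1) t by (simp add: algebra_simps flip: ennreal_mult ennreal_plus)
      also have "\<dots> \<le> ennreal ((C1 powr (1 / p) + C2) * G * t * ((1 / k) powr (\<alpha> / q) * (1 - ln t) powr (\<alpha> / q)))"
        using C2 real(1) t Lt by (intro ennreal_leI mult_left_mono) auto
      also have "\<dots> = ennreal (C * G * t * (1 - ln t) powr (\<alpha> / q))"
        by (simp add: C_def algebra_simps)
      finally have "ennreal (t powr -1 * (1 - ln t) powr (- \<alpha> / q)) * K_fun \<Omega> p q f t
          \<le> ennreal (t powr -1 * (1 - ln t) powr (- \<alpha> / q)) * ennreal (C * G * t * (1 - ln t) powr (\<alpha> / q))"
        by (rule mult_left_mono) simp
      also have "\<dots> = ennreal (C * G)"
      proof -
        have "1 - ln t \<noteq> 0" using lnt by linarith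
        then show ?thesis
          using C real(1) t by (simp add: powr_minus_divide field_simps flip: ennreal_mult)
      qed
      also have "\<dots> = ennreal C * grand_norm \<Omega> q \<alpha> f"
        using C real by (simp add: ennreal_mult)
      finally show "ennreal (t powr -1 * (1 - ln t) powr (- \<alpha> / q)) * K_fun \<Omega> p q f t
        \<le> ennreal C * grand_norm \<Omega> q \<alpha> f" .
    qed
  qed
  with C show ?thesis by (rule that)
qed

end

theorem theorem3p1:
  fixes \<Omega> :: "'a::euclidean_space set" and p q \<alpha> :: real
  assumes "open \<Omega>" and "bounded \<Omega>" and "emeasure lebesgue \<Omega> = 1"
    and "1 \<le> p" and "p < q" and "0 < \<alpha>"
  shows "\<exists>c C. 0 < c \<and> 0 < C \<and>
     (\<forall>f \<in> borel_measurable (lebesgue_on \<Omega>).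
        ennreal c * grand_norm \<Omega> q \<alpha> f \<le> interp_norm \<Omega> p q (- \<alpha> / q) f \<and>
        interp_norm \<Omega> p q (- \<alpha> / q) f \<le> ennreal C * grand_norm \<Omega> q \<alpha> f)"
proof -
  interpret unit_volume \<Omega>
    using assms(1,3) by unfold_locales auto
  from grand_le_interp[OF assms(4-6)] interp_le_grand[OF assms(4-6)] show ?thesis
    by metis
qed

end
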